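(* Let $(I,\mathcal{I},\Lambda)$ be a probability space, let $\mathcal{F}(I)$ be the space of real-valued functions on $I$, and let $\mathbf{X}=\{X_{\mathbf{t}}\}_{\mathbf{t}\in I}$ be a random element in $\mathcal{F}(I)$ such that, for each $\mathbf{t}\in I$, $X_{\mathbf{t}}$ has a continuous distribution function $F_{\mathbf{t}}$ which is strictly increasing in a neighbourhood of the median $m_{\mathbf{t}}$ of $X_{\mathbf{t}}$. Let $\mathbf{m}_c = \{m_{\mathbf{t}}\}_{\mathbf{t}\in I}$. Then: (1) $\mathbf{m}_c$ is a maximizer of the modified band depth $MBD$, of the modified half-region depth $MHRD$, and of the integrated data depth $IDD$. (2) Any $\mathbf{m}_c^{*} \in \mathcal{F}(I)$ which equals $\mathbf{m}_c$ for $\mathbf{t}\in I$ except on a set of $\Lambda$-measure zero is also a maximizer of $MBD$ and of $IDD$. (3) Any $\mathbf{m}_c^{**} = \{m_{\mathbf{t}}^{**}\}_{\mathbf{t}\in I} \in \mathcal{F}(I)$ satisfying $\int_I F_{\mathbf{t}}(m_{\mathbf{t}}^{**})\,\Lambda(d\mathbf{t}) = 1/2$ is a maximizer of $MHRD$.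
   Context: All depths are relative to the distribution of $\mathbf{X}$. For $\mathbf{x}=\{x_{\mathbf{t}}\}_{\mathbf{t}\in I}\in\mathcal{F}(I)$ and a fixed integer $J\ge 2$, with $\mathbf{X}_i=\{X_{i,\mathbf{t}}\}_{\mathbf{t}\in I}$, $1\le i\le J$, independent copies of $\mathbf{X}$, the modified band depth is $$MBD(\mathbf{x}) = \sum_{j=2}^{J} E\left[\int_I \mathbf{1}\left(\min_{i=1,\ldots,j} X_{i,\mathbf{t}} \le x_{\mathbf{t}} \le \max_{i=1,\ldots,j} X_{i,\mathbf{t}}\right)\Lambda(d\mathbf{t})\right].$$ The modified half-region depth is $$MHRD(\mathbf{x}) = \min\left\{E\left[\int_I \mathbf{1}(X_{\mathbf{t}}\le x_{\mathbf{t}})\,\Lambda(d\mathbf{t})\right],\ E\left[\int_I \mathbf{1}(X_{\mathbf{t}}\ge x_{\mathbf{t}})\,\Lambda(d\mathbf{t})\right]\right\}.$$ The integrated data depth is $$IDD(\mathbf{x}) = \int_I D_{\mathbf{t}}(x_{\mathbf{t}})\,\Lambda(d\mathbf{t}),$$ where, for each $\mathbf{t}\in I$, $D_{\mathbf{t}}$ is a depth function on the real line (a real-valued function on $\mathbb{R}$ depending on the distribution of $X_{\mathbf{t}}$). Standing assumption: for each $\mathbf{t}\in I$, $D_{\mathbf{t}}$ is maximized at the median of $X_{\mathbf{t}}$ whenever $X_{\mathbf{t}}$ has a continuous distribution. It is implicitly assumed that the measurability needed for these integrals and expectations to be well defined (and for Fubini's theorem to apply) holds, in particular for the functions $\mathbf{x}$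 being compared and for $\mathbf{m}_c,\mathbf{m}_c^*,\mathbf{m}_c^{**}$. A maximizer of a depth is a point of $\mathcal{F}(I)$ whose depth is at least that of every other point of $\mathcal{F}(I)$ for which the depth is defined. *)

theory Defs
  imports "HOL-Probability.Probability"
begin

text \<open>
  The index space is a probability space \<open>L\<close> with \<open>I = space L\<close>.  A point of the function
  space over \<open>I\<close> is a function \<open>x :: 'i \<Rightarrow> real\<close>, of which only the values on \<open>space L\<close> matter.  A random
  element is a map \<open>X :: 'w \<Rightarrow> 'i \<Rightarrow> real\<close> which, restricted to \<open>I\<close>, is measurable
  for the product (cylinder) sigma-algebra.
\<close>

abbreviation paths :: "'i measure \<Rightarrow> ('i \<Rightarrow> real) measure" where
  "paths L \<equiv> PiM (space L) (\<lambda>_. borel)"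

definition random_element :: "'w measure \<Rightarrow> 'i measure \<Rightarrow> ('w \<Rightarrow> 'i \<Rightarrow> real) \<Rightarrow> bool" where
  "random_element M L X \<longleftrightarrow> (\<lambda>\<omega>. restrict (X \<omega>) (space L)) \<in> M \<rightarrow>\<^sub>M paths L"

text \<open>The copies may live on a probability space \<open>N\<close> different from the one carrying \<open>X\<close>.\<close>

definition independent_copies ::
  "'w measure \<Rightarrow> 'i measure \<Rightarrow> ('w \<Rightarrow> 'i \<Rightarrow> real) \<Rightarrow> 'v measure \<Rightarrow> nat set
    \<Rightarrow> (nat \<Rightarrow> 'v \<Rightarrow> 'i \<Rightarrow> real) \<Rightarrow> bool" where
  "independent_copies M L X N K Y \<longleftrightarrow>
     prob_space.indep_vars N (\<lambda>_. paths L) (\<lambda>i \<omega>. restrict (Y i \<omega>) (space L)) K \<and>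
     (\<forall>i\<in>K. distr N (paths L) (\<lambda>\<omega>. restrict (Y i \<omega>) (space L)) =
             distr M (paths L) (\<lambda>\<omega>. restrict (X \<omega>) (space L)))"

definition marginal :: "'w measure \<Rightarrow> ('w \<Rightarrow> 'i \<Rightarrow> real) \<Rightarrow> 'i \<Rightarrow> real measure" where
  "marginal M X t = distr M borel (\<lambda>\<omega>. X \<omega> t)"

definition is_median :: "real measure \<Rightarrow> real \<Rightarrow> bool" where
  "is_median \<mu> a \<longleftrightarrow> measure \<mu> {..a} \<ge> 1/2 \<and> measure \<mu> {a..} \<ge> 1/2"

text \<open>
  Each depth comes with a predicate singling out the functions at which it is defined.  For the
  first two depths this is joint measurability of the integrand, so that both iterated integrals
  exist and Fubini's theorem applies.
\<close>

definition in_band :: "(nat \<Rightarrow> 'v \<Rightarrow> 'i \<Rightarrow> real) \<Rightarrow> nat \<Rightarrow> ('i \<Rightarrow> real) \<Rightarrow> 'v \<Rightarrow> 'i \<Rightarrow> bool" where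
  "in_band Y j x \<omega> t \<longleftrightarrow>
     (MIN i\<in>{1..j}. Y i \<omega> t) \<le> x t \<and> x t \<le> (MAX i\<in>{1..j}. Y i \<omega> t)"

definition MBD_defined ::
  "'v measure \<Rightarrow> 'i measure \<Rightarrow> nat \<Rightarrow> (nat \<Rightarrow> 'v \<Rightarrow> 'i \<Rightarrow> real) \<Rightarrow> ('i \<Rightarrow> real) \<Rightarrow> bool" where
  "MBD_defined N L J Y x \<longleftrightarrow>
     (\<forall>j\<in>{2..J}. Measurable.pred (N \<Otimes>\<^sub>M L) (\<lambda>(\<omega>, t). in_band Y j x \<omega> t))"

definition MBD ::
  "'v measure \<Rightarrow> 'i measure \<Rightarrow> nat \<Rightarrow> (nat \<Rightarrow> 'v \<Rightarrow> 'i \<Rightarrow> real) \<Rightarrow> ('i \<Rightarrow> real) \<Rightarrow> real" where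
  "MBD N L J Y x = (\<Sum>j=2..J. \<integral>\<omega>. (\<integral>t. of_bool (in_band Y j x \<omega> t) \<partial>L) \<partial>N)"

definition MHRD_defined ::
  "'w measure \<Rightarrow> 'i measure \<Rightarrow> ('w \<Rightarrow> 'i \<Rightarrow> real) \<Rightarrow> ('i \<Rightarrow> real) \<Rightarrow> bool" where
  "MHRD_defined M L X x \<longleftrightarrow>
     Measurable.pred (M \<Otimes>\<^sub>M L) (\<lambda>(\<omega>, t). X \<omega> t \<le> x t) \<and>
     Measurable.pred (M \<Otimes>\<^sub>M L) (\<lambda>(\<omega>, t). X \<omega> t \<ge> x t)"

definition MHRD ::
  "'w measure \<Rightarrow> 'i measure \<Rightarrow> ('w \<Rightarrow> 'i \<Rightarrow> real) \<Rightarrow> ('i \<Rightarrow> real) \<Rightarrow> real" where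
  "MHRD M L X x =
     min (\<integral>\<omega>. (\<integral>t. of_bool (X \<omega> t \<le> x t) \<partial>L) \<partial>M)
         (\<integral>\<omega>. (\<integral>t. of_bool (X \<omega> t \<ge> x t) \<partial>L) \<partial>M)"

text \<open>
  The univariate depths \<open>D t\<close> take the distribution as first argument.  They are arbitrary
  real-valued functions, possibly unbounded, so the integral is the extended-valued Lebesgue
  integral (positive part minus negative part), defined unless it is of the form
  \<open>\<infinity> - \<infinity>\<close>; in the integrable case it is the Bochner integral.
\<close>

definition IDD_defined ::
  "'w measure \<Rightarrow> 'i measure \<Rightarrow> ('w \<Rightarrow> 'i \<Rightarrow> real) \<Rightarrow> ('i \<Rightarrow> real measure \<Rightarrow> real \<Rightarrow> real)
    \<Rightarrow> ('i \<Rightarrow> real) \<Rightarrow> bool" where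
  "IDD_defined M L X D x \<longleftrightarrow>
     (\<lambda>t. D t (marginal M X t) (x t)) \<in> borel_measurable L \<and>
     ((\<integral>\<^sup>+t. ennreal (D t (marginal M X t) (x t)) \<partial>L) < \<infinity> \<or>
      (\<integral>\<^sup>+t. ennreal (- D t (marginal M X t) (x t)) \<partial>L) < \<infinity>)"

definition IDD ::
  "'w measure \<Rightarrow> 'i measure \<Rightarrow> ('w \<Rightarrow> 'i \<Rightarrow> real) \<Rightarrow> ('i \<Rightarrow> real measure \<Rightarrow> real \<Rightarrow> real)
    \<Rightarrow> ('i \<Rightarrow> real) \<Rightarrow> ereal" where
  "IDD M L X D x =
     enn2ereal (\<integral>\<^sup>+t. ennreal (D t (marginal M X t) (x t)) \<partial>L) -
     enn2ereal (\<integral>\<^sup>+t. ennreal (- D t (marginal M X t) (x t)) \<partial>L)"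

lemma IDD_eq_lebesgue_integral:
  assumes "integrable L (\<lambda>t. D t (marginal M X t) (x t))"
  shows "IDD_defined M L X D x"
    and "IDD M L X D x = ereal (\<integral>t. D t (marginal M X t) (x t) \<partial>L)"
proof -
  let ?f = "\<lambda>t. D t (marginal M X t) (x t)"
  have fin: "(\<integral>\<^sup>+t. ennreal (?f t) \<partial>L) \<noteq> \<infinity>" "(\<integral>\<^sup>+t. ennreal (- ?f t) \<partial>L) \<noteq> \<infinity>"
    using assms by (auto simp: real_integrable_def)
  then show "IDD_defined M L X D x"
    using assms by (auto simp: IDD_defined_def less_top)
  have e: "enn2ereal a = ereal (enn2real a)" if "a \<noteq> \<infinity>" for a
    using that by (cases a) auto
  show "IDD M L X D x = ereal (\<integral>t. ?f t \<partial>L)"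
    unfolding IDD_def real_lebesgue_integral_def[OF assms] e[OF fin(1)] e[OF fin(2)] by simp
qed

definition is_maximizer ::
  "(('i \<Rightarrow> real) \<Rightarrow> bool) \<Rightarrow> (('i \<Rightarrow> real) \<Rightarrow> 'b::order) \<Rightarrow> ('i \<Rightarrow> real) \<Rightarrow> bool" where
  "is_maximizer dfd depth x \<longleftrightarrow> dfd x \<and> (\<forall>y. dfd y \<longrightarrow> depth y \<le> depth x)"

end

theory Submission
  imports Defs
begin

text \<open>
  The median maximizes the integrand of \<open>IDD\<close> pointwise.  By Fubini, the other two depths are also
  integrals over the index space of univariate quantities.  For the band depth the integrand at \<open>t\<close> is \<open>1 - F\<^sup>j - (1 - F)\<^sup>j\<close> with \<open>F = F\<^sub>t (x\<^sub>t)\<close>, maximal at \<open>F = 1/2\<close> by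
  convexity of powers.  For the half-region depth the two expectations sum to \<open>1\<close>, so their minimum
  is at most \<open>1/2\<close>, with equality as soon as one of them is \<open>1/2\<close>.
\<close>

section \<open>The power inequality, and continuous distribution functions on the line\<close>

lemma power_sum_ge_half_powers:
  fixes p :: real
  assumes "0 \<le> p" "p \<le> 1"
  shows "2 * (1/2) ^ j \<le> p ^ j + (1 - p) ^ j"
proof -
  have "convex_on {0..} (\<lambda>x::real. x ^ j)"
  \<comment> \<open>Even powers are convex on the whole line, odd powers in general only on the
    nonnegative half-line, hence the case split.\<close>
  proof (cases "even j")
    case True
    show ?thesis
      by (rule convex_on_subset[OF convex_power_even[OF True]]) auto
  qed (rule convex_power_odd)
  then have conv: "((1 - 1/2) *\<^sub>R p + (1/2) *\<^sub>R (1 - p)) ^ j \<le> (1 - 1/2) * p ^ j + (1/2) * (1 - p) ^ j"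
    by (rule convex_onD) (use assms in auto)
  have mid: "(1 - 1/2) *\<^sub>R p + (1/2) *\<^sub>R (1 - p) = 1/2"
    by (simp add: field_simps)
  show ?thesis
    using conv unfolding mid by simp
qed

context real_distribution
begin

text \<open>Continuity of the distribution function at \<open>a\<close> rules out an atom there, so
  open and closed half-lines ending at \<open>a\<close> carry the same mass.\<close>

lemma continuous_cdf_measure:
  assumes "continuous_on UNIV (cdf M)"
  shows "measure M {..<a} = cdf M a" "measure M {a..} = 1 - cdf M a"
    "measure M {a<..} = 1 - cdf M a"
proof -
  have "measure M {a} = 0"
    using assms isCont_cdf[of a] by (simp add: continuous_on_eq_continuous_at)
  moreover have "measure M {..a} = measure M {..<a} + measure M {a}"
    by (subst finite_measure_Union[symmetric]) (auto intro!: arg_cong[where f="measure M"])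
  ultimately show 1: "measure M {..<a} = cdf M a"
    by (simp add: cdf_def)
  show "measure M {a..} = 1 - cdf M a"
    using prob_compl[of "{..<a}"] 1 by (simp add: Compl_eq_Diff_UNIV[symmetric])
  show "measure M {a<..} = 1 - cdf M a"
    using prob_compl[of "{..a}"] by (simp add: Compl_eq_Diff_UNIV[symmetric] cdf_def)
qed

text \<open>Without atoms the two inequalities of \<open>is_median\<close> read
  \<open>cdf M a \<ge> 1/2\<close> and \<open>1 - cdf M a \<ge> 1/2\<close>.\<close>

lemma cdf_median:
  assumes "continuous_on UNIV (cdf M)" "is_median M a"
  shows "cdf M a = 1/2"
  using assms(2) unfolding is_median_def continuous_cdf_measure[OF assms(1)] by (simp add: cdf_def)

end

text \<open>A jointly measurable integrand bounded by 1 is integrable on the product of two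
  probability spaces, so the order of integration may be exchanged. This turns an expected
  occupation time into an integral of probabilities over the index space; the integrability is what
  later monotonicity and linearity arguments require.\<close>

lemma Fubini_of_bool:
  assumes "prob_space M" "prob_space L" "Measurable.pred (M \<Otimes>\<^sub>M L) (\<lambda>(\<omega>, t). P \<omega> t)"
  shows "(\<integral>\<omega>. (\<integral>t. of_bool (P \<omega> t) \<partial>L) \<partial>M) = (\<integral>t. measure M {\<omega>\<in>space M. P \<omega> t} \<partial>L)"
    and "integrable L (\<lambda>t. measure M {\<omega>\<in>space M. P \<omega> t})"
proof -
  interpret M: prob_space M by fact
  interpret L: prob_space L by fact
  interpret pair_prob_space M L ..
  have int: "integrable (M \<Otimes>\<^sub>M L) (\<lambda>(\<omega>, t). of_bool (P \<omega> t) :: real)"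
  proof (rule integrable_const_bound[where B = 1])
    show "(\<lambda>(\<omega>, t). of_bool (P \<omega> t) :: real) \<in> borel_measurable (M \<Otimes>\<^sub>M L)"
      using measurable_compose[OF assms(3), of "of_bool :: bool \<Rightarrow> real" borel]
      by (simp add: split_beta')
  qed auto
  \<comment> \<open>This holds for every \<open>t\<close>: if the set is not measurable, both sides
    take the default value 0.\<close>
  have inner: "(\<integral>\<omega>. of_bool (P \<omega> t) \<partial>M) = measure M {\<omega>\<in>space M. P \<omega> t}" for t
  proof -
    have "(\<integral>\<omega>. of_bool (P \<omega> t) \<partial>M) = (\<integral>\<omega>. indicator {\<omega>\<in>space M. P \<omega> t} \<omega> \<partial>M)"
      by (intro Bochner_Integration.integral_cong) (auto simp: indicator_def)
    also have "\<dots> = measure M {\<omega>\<in>space M. P \<omega> t}"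
      by (simp add: Int_absorb2 subset_eq)
    finally show ?thesis .
  qed
  show "(\<integral>\<omega>. (\<integral>t. of_bool (P \<omega> t) \<partial>L) \<partial>M) = (\<integral>t. measure M {\<omega>\<in>space M. P \<omega> t} \<partial>L)"
    unfolding Fubini_integral[OF int, symmetric]
    by (intro Bochner_Integration.integral_cong) (auto simp: inner)
  show "integrable L (\<lambda>t. measure M {\<omega>\<in>space M. P \<omega> t})"
    using integrable_snd[OF int]
    by (rule Bochner_Integration.integrable_cong[THEN iffD1, rotated 2]) (auto simp: inner)
qed

section \<open>Marginals of random elements and of their independent copies\<close>

lemma random_element_measurable:
  assumes "random_element M L X" "t \<in> space L"
  shows "(\<lambda>\<omega>. X \<omega> t) \<in> borel_measurable M"
proof -
  have "(\<lambda>\<omega>. restrict (X \<omega>) (space L) t) \<in> borel_measurable M"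
    using assms unfolding random_element_def by (rule measurable_compose[OF _ measurable_component_singleton])
  then show ?thesis using assms(2) by simp
qed

lemma real_distribution_marginal:
  assumes "prob_space M" "random_element M L X" "t \<in> space L"
  shows "real_distribution (marginal M X t)"
  unfolding marginal_def
  by (rule prob_space.real_distribution_distr[OF assms(1) random_element_measurable[OF assms(2,3)]])

lemma measure_marginal:
  assumes "random_element M L X" "t \<in> space L" "A \<in> sets borel"
  shows "measure (marginal M X t) A = measure M {\<omega>\<in>space M. X \<omega> t \<in> A}"
  unfolding marginal_def measure_distr[OF random_element_measurable[OF assms(1,2)] assms(3)]
  by (auto intro!: arg_cong[where f = "measure M"])

lemma independent_copies_random_element:
  assumes "prob_space N" "independent_copies M L X N K Y" "i \<in> K"
  shows "random_element N L (Y i)"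
proof -
  interpret N: prob_space N by fact
  show ?thesis
    using assms by (auto simp: independent_copies_def random_element_def N.indep_vars_def)
qed

text \<open>Copies are compared through their laws on path space; writing the marginal as the image
  of that law under evaluation at \<open>t\<close> shows that equal path laws have equal
  marginals.\<close>

lemma marginal_eq_distr_paths:
  assumes "random_element M L X" "t \<in> space L"
  shows "marginal M X t =
    distr (distr M (paths L) (\<lambda>\<omega>. restrict (X \<omega>) (space L))) borel (\<lambda>x. x t)"
  using assms unfolding random_element_def
  by (subst distr_distr) (auto simp: marginal_def comp_def intro: measurable_component_singleton)

lemma independent_copies_marginal:
  assumes "prob_space N" "random_element M L X" "independent_copies M L X N K Y"
    "i \<in> K" "t \<in> space L"
  shows "marginal N (Y i) t = marginal M X t"
  using assms independent_copies_random_element[OF assms(1,3,4)]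
  by (simp add: marginal_eq_distr_paths independent_copies_def)

lemma independent_copies_prob_all:
  assumes "prob_space N" "random_element M L X" "independent_copies M L X N K Y"
    "t \<in> space L" "S \<subseteq> K" "S \<noteq> {}" "finite S" "A \<in> sets borel"
  shows "measure N {\<omega>\<in>space N. \<forall>i\<in>S. Y i \<omega> t \<in> A} = measure (marginal M X t) A ^ card S"
proof -
  interpret N: prob_space N by fact
  have "N.indep_vars (\<lambda>_. paths L) (\<lambda>i \<omega>. restrict (Y i \<omega>) (space L)) K"
    using assms(3) by (simp add: independent_copies_def)
  \<comment> \<open>Evaluation at \<open>t\<close> is measurable for the product sigma-algebra, so
    independence of the paths passes to their values at \<open>t\<close>.\<close>
  from N.indep_vars_compose2[OF this, where Y = "\<lambda>_ x. x t" and N = "\<lambda>_. borel"]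
  have ind: "N.indep_vars (\<lambda>_. borel) (\<lambda>i \<omega>. Y i \<omega> t) K"
    using assms(4) by (simp add: measurable_component_singleton)
  have "measure N {\<omega>\<in>space N. \<forall>i\<in>S. Y i \<omega> t \<in> A} =
      measure N (\<Inter>i\<in>S. (\<lambda>\<omega>. Y i \<omega> t) -` A \<inter> space N)"
    using assms(6) by (auto intro!: arg_cong[where f = "measure N"])
  also have "\<dots> = (\<Prod>i\<in>S. measure N ((\<lambda>\<omega>. Y i \<omega> t) -` A \<inter> space N))"
    by (rule N.indep_varsD[OF ind]) (use assms in auto)
  also have "\<dots> = (\<Prod>i\<in>S. measure (marginal M X t) A)"
  proof (rule prod.cong)
    fix i assume "i \<in> S"
    then have i: "i \<in> K" using assms(5) by auto
    show "measure N ((\<lambda>\<omega>. Y i \<omega> t) -` A \<inter> space N) = measure (marginal M X t) A"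
      using measure_marginal[OF independent_copies_random_element[OF assms(1,3) i] assms(4,8)]
        independent_copies_marginal[OF assms(1-3) i assms(4)]
      by (simp add: vimage_def Int_def conj_commute)
  qed simp
  finally show ?thesis by simp
qed

section \<open>Modified band depth\<close>

text \<open>The value \<open>x t\<close> is outside the band exactly when all \<open>j\<close>
  copies lie strictly below it or all lie strictly above it. These events are disjoint, and by
  independence and continuity their probabilities are the \<open>j\<close>-th powers of
  \<open>F\<close> and \<open>1 - F\<close>, where \<open>F\<close> is the marginal distribution
  function at \<open>x t\<close>.\<close>

lemma prob_in_band:
  assumes "prob_space M" "prob_space N" "random_element M L X" "independent_copies M L X N {1..J} Y"
    "t \<in> space L" "continuous_on UNIV (cdf (marginal M X t))" "1 \<le> j" "j \<le> J"
  shows "measure N {\<omega>\<in>space N. in_band Y j x \<omega> t} =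
    1 - cdf (marginal M X t) (x t) ^ j - (1 - cdf (marginal M X t) (x t)) ^ j"
proof -
  interpret N: prob_space N by fact
  interpret D: real_distribution "marginal M X t"
    by (rule real_distribution_marginal[OF assms(1,3,5)])
  let ?B = "\<lambda>A. {\<omega>\<in>space N. \<forall>i\<in>{1..j}. Y i \<omega> t \<in> A}"
  have [measurable]: "(\<lambda>\<omega>. Y i \<omega> t) \<in> borel_measurable N" if "i \<in> {1..j}" for i
    using that assms(8) independent_copies_random_element[OF assms(2,4)]
    by (intro random_element_measurable[OF _ assms(5)]) auto
  have meas: "?B A \<in> sets N" if "A \<in> sets borel" for A
    using that by measurable
  have prob: "measure N (?B A) = measure (marginal M X t) A ^ j" if "A \<in> sets borel" for A
    using independent_copies_prob_all[OF assms(2-5) _ _ _ that, of "{1..j}"] assms(7,8) by simp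
  have "in_band Y j x \<omega> t \<longleftrightarrow>
      \<not> (\<forall>i\<in>{1..j}. Y i \<omega> t \<in> {..<x t}) \<and> \<not> (\<forall>i\<in>{1..j}. Y i \<omega> t \<in> {x t<..})" for \<omega>
  proof -
    have "(\<lambda>i. Y i \<omega> t) ` {1..j} \<noteq> {}" using assms(7) by auto
    then show ?thesis
      by (auto simp: in_band_def Min_le_iff Max_ge_iff not_less)
  qed
  then have "{\<omega>\<in>space N. in_band Y j x \<omega> t} = space N - (?B {..<x t} \<union> ?B {x t<..})"
    by auto
  then have "measure N {\<omega>\<in>space N. in_band Y j x \<omega> t} = 1 - measure N (?B {..<x t} \<union> ?B {x t<..})"
    using meas by (simp add: N.prob_compl sets.Un)
  also have "measure N (?B {..<x t} \<union> ?B {x t<..}) = measure N (?B {..<x t}) + measure N (?B {x t<..})"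
  proof (rule N.finite_measure_Union)
    \<comment> \<open>Disjointness rests on \<open>1 \<le> j\<close>: with no copies at all, both
      events would hold vacuously.\<close>
    show "?B {..<x t} \<inter> ?B {x t<..} = {}" using assms(7) by force
  qed (auto intro: meas)
  finally show ?thesis
    unfolding prob[OF borel_open[OF open_lessThan]] prob[OF borel_open[OF open_greaterThan]]
      D.continuous_cdf_measure[OF assms(6)] by simp
qed

text \<open>After Fubini, each summand is compared pointwise in \<open>t\<close>. The median
  condition is imposed almost everywhere so that modifications of the median on null sets are
  covered as well.\<close>

lemma MBD_maximizer:
  assumes "prob_space L" "prob_space M" "prob_space N" "random_element M L X"
    "independent_copies M L X N {1..J} Y"
    "\<And>t. t \<in> space L \<Longrightarrow> continuous_on UNIV (cdf (marginal M X t))"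
    "AE t in L. is_median (marginal M X t) (m t)" "MBD_defined N L J Y m"
  shows "is_maximizer (MBD_defined N L J Y) (MBD N L J Y) m"
  unfolding is_maximizer_def
proof (intro conjI allI impI)
  fix x assume x: "MBD_defined N L J Y x"
  show "MBD N L J Y x \<le> MBD N L J Y m"
    unfolding MBD_def
  proof (rule sum_mono)
    fix j assume j: "j \<in> {2..J}"
    have Fub: "Measurable.pred (N \<Otimes>\<^sub>M L) (\<lambda>(\<omega>, t). in_band Y j y \<omega> t)" if "MBD_defined N L J Y y" for y
      using that j by (simp add: MBD_defined_def)
    have "AE t in L. measure N {\<omega>\<in>space N. in_band Y j x \<omega> t} \<le> measure N {\<omega>\<in>space N. in_band Y j m \<omega> t}"
      using assms(7) AE_space
    proof eventually_elim
      case (elim t)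
      interpret D: real_distribution "marginal M X t"
        by (rule real_distribution_marginal[OF assms(2,4) elim(2)])
      have F: "measure N {\<omega>\<in>space N. in_band Y j y \<omega> t} =
          1 - cdf (marginal M X t) (y t) ^ j - (1 - cdf (marginal M X t) (y t)) ^ j" for y
        using j by (intro prob_in_band[OF assms(2-5) elim(2) assms(6)[OF elim(2)]]) auto
      show ?case
        using power_sum_ge_half_powers[of "cdf (marginal M X t) (x t)" j]
        by (simp add: F D.cdf_median[OF assms(6)[OF elim(2)] elim(1)] D.cdf_nonneg D.cdf_bounded_prob)
    qed
    then show "(\<integral>\<omega>. (\<integral>t. of_bool (in_band Y j x \<omega> t) \<partial>L) \<partial>N)
        \<le> (\<integral>\<omega>. (\<integral>t. (of_bool (in_band Y j m \<omega> t) :: real) \<partial>L) \<partial>N)"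
      unfolding Fubini_of_bool(1)[OF assms(3,1) Fub[OF x]] Fubini_of_bool(1)[OF assms(3,1) Fub[OF assms(8)]]
      by (rule integral_mono_AE[OF Fubini_of_bool(2)[OF assms(3,1) Fub[OF x]]
            Fubini_of_bool(2)[OF assms(3,1) Fub[OF assms(8)]]])
  qed
qed fact

section \<open>Modified half-region depth\<close>

text \<open>By continuity the two half-line probabilities at each \<open>t\<close> add up to 1, so
  the depth depends on \<open>x\<close> only through the single number \<open>c\<close>.\<close>

lemma MHRD_eq:
  assumes "prob_space L" "prob_space M" "random_element M L X"
    "\<And>t. t \<in> space L \<Longrightarrow> continuous_on UNIV (cdf (marginal M X t))" "MHRD_defined M L X x"
  defines "c \<equiv> \<integral>t. cdf (marginal M X t) (x t) \<partial>L"
  shows "MHRD M L X x = min c (1 - c)"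
proof -
  interpret L: prob_space L by fact
  have le: "Measurable.pred (M \<Otimes>\<^sub>M L) (\<lambda>(\<omega>, t). X \<omega> t \<le> x t)"
    and ge: "Measurable.pred (M \<Otimes>\<^sub>M L) (\<lambda>(\<omega>, t). x t \<le> X \<omega> t)"
    using assms(5) by (auto simp: MHRD_defined_def)
  have Fle: "measure M {\<omega>\<in>space M. X \<omega> t \<le> x t} = cdf (marginal M X t) (x t)"
    and Fge: "measure M {\<omega>\<in>space M. x t \<le> X \<omega> t} = 1 - cdf (marginal M X t) (x t)"
    if t: "t \<in> space L" for t
  proof -
    interpret D: real_distribution "marginal M X t"
      by (rule real_distribution_marginal[OF assms(2,3) t])
    show "measure M {\<omega>\<in>space M. X \<omega> t \<le> x t} = cdf (marginal M X t) (x t)"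
      using measure_marginal[OF assms(3) t, of "{..x t}"] by (simp add: cdf_def)
    show "measure M {\<omega>\<in>space M. x t \<le> X \<omega> t} = 1 - cdf (marginal M X t) (x t)"
      using measure_marginal[OF assms(3) t, of "{x t..}"] D.continuous_cdf_measure(2)[OF assms(4)[OF t]]
      by simp
  qed
  have int: "integrable L (\<lambda>t. cdf (marginal M X t) (x t))"
    using Fubini_of_bool(2)[OF assms(2,1) le]
    by (rule Bochner_Integration.integrable_cong[THEN iffD1, rotated 2]) (auto simp: Fle)
  have "(\<integral>\<omega>. (\<integral>t. of_bool (X \<omega> t \<le> x t) \<partial>L) \<partial>M) = c"
    unfolding Fubini_of_bool(1)[OF assms(2,1) le] c_def
    by (intro Bochner_Integration.integral_cong) (auto simp: Fle)
  moreover have "(\<integral>\<omega>. (\<integral>t. of_bool (x t \<le> X \<omega> t) \<partial>L) \<partial>M) =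
      (\<integral>t. 1 - cdf (marginal M X t) (x t) \<partial>L)"
    unfolding Fubini_of_bool(1)[OF assms(2,1) ge]
    by (intro Bochner_Integration.integral_cong) (auto simp: Fge)
  moreover have "(\<integral>t. 1 - cdf (marginal M X t) (x t) \<partial>L) = 1 - c"
    using int by (simp add: c_def L.prob_space)
  ultimately show ?thesis by (simp add: MHRD_def)
qed

lemma MHRD_maximizer:
  assumes "prob_space L" "prob_space M" "random_element M L X"
    "\<And>t. t \<in> space L \<Longrightarrow> continuous_on UNIV (cdf (marginal M X t))"
    "(\<integral>t. cdf (marginal M X t) (m t) \<partial>L) = 1/2" "MHRD_defined M L X m"
  shows "is_maximizer (MHRD_defined M L X) (MHRD M L X) m"
  using assms(5,6) by (auto simp: is_maximizer_def MHRD_eq[OF assms(1-4)] min_def)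

text \<open>Brings the pointwise median under the criterion of \<open>MHRD_maximizer\<close>: the
  integrand is constantly 1/2.\<close>

lemma integral_cdf_median:
  assumes "prob_space L" "prob_space M" "random_element M L X"
    "\<And>t. t \<in> space L \<Longrightarrow> continuous_on UNIV (cdf (marginal M X t))"
    "\<And>t. t \<in> space L \<Longrightarrow> is_median (marginal M X t) (m t)"
  shows "(\<integral>t. cdf (marginal M X t) (m t) \<partial>L) = 1/2"
proof -
  interpret L: prob_space L by fact
  have "(\<integral>t. cdf (marginal M X t) (m t) \<partial>L) = (\<integral>t. 1/2 \<partial>L)"
    by (intro Bochner_Integration.integral_cong refl
        real_distribution.cdf_median real_distribution_marginal[OF assms(2,3)] assms(4,5))
  then show ?thesis by (simp add: L.prob_space)
qed

section \<open>Integrated data depth and conclusion\<close>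

text \<open>Integrability is not guaranteed, so positive and negative parts are compared separately:
  pointwise maximality makes the first integral largest and the second smallest, and extended
  subtraction respects both inequalities.\<close>

lemma IDD_maximizer:
  assumes "AE t in L. \<forall>y. D t (marginal M X t) y \<le> D t (marginal M X t) (m t)" "IDD_defined M L X D m"
  shows "is_maximizer (IDD_defined M L X D) (IDD M L X D) m"
  unfolding is_maximizer_def IDD_def
proof (intro conjI allI impI ereal_minus_mono)
  fix x
  show "enn2ereal (\<integral>\<^sup>+t. ennreal (D t (marginal M X t) (x t)) \<partial>L)
      \<le> enn2ereal (\<integral>\<^sup>+t. ennreal (D t (marginal M X t) (m t)) \<partial>L)"
    unfolding less_eq_ennreal.rep_eq[symmetric]
    by (rule nn_integral_mono_AE) (use assms(1) in eventually_elim, auto intro: ennreal_leI)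
  show "enn2ereal (\<integral>\<^sup>+t. ennreal (- D t (marginal M X t) (m t)) \<partial>L)
      \<le> enn2ereal (\<integral>\<^sup>+t. ennreal (- D t (marginal M X t) (x t)) \<partial>L)"
    unfolding less_eq_ennreal.rep_eq[symmetric]
    by (rule nn_integral_mono_AE) (use assms(1) in eventually_elim, auto intro: ennreal_leI)
qed fact

theorem theorem2p3:
  fixes L :: "'i measure" and M :: "'w measure" and N :: "'v measure"
    and X :: "'w \<Rightarrow> 'i \<Rightarrow> real" and Y :: "nat \<Rightarrow> 'v \<Rightarrow> 'i \<Rightarrow> real" and J :: nat
    and m :: "'i \<Rightarrow> real" and D :: "'i \<Rightarrow> real measure \<Rightarrow> real \<Rightarrow> real"
  assumes "prob_space L" and "prob_space M" and "prob_space N"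
    and "random_element M L X"
    and "J \<ge> 2"
    and "independent_copies M L X N {1..J} Y"
    and "\<And>t. t \<in> space L \<Longrightarrow> continuous_on UNIV (cdf (marginal M X t))"
    and "\<And>t. t \<in> space L \<Longrightarrow> is_median (marginal M X t) (m t)"
    and "\<And>t. t \<in> space L \<Longrightarrow>
           \<exists>\<epsilon>>0. strict_mono_on {m t - \<epsilon> <..< m t + \<epsilon>} (cdf (marginal M X t))"
    and "\<And>t a y. \<lbrakk>t \<in> space L; continuous_on UNIV (cdf (marginal M X t));
                   is_median (marginal M X t) a\<rbrakk>
           \<Longrightarrow> D t (marginal M X t) y \<le> D t (marginal M X t) a"
  shows
    "((MBD_defined N L J Y m \<longrightarrow> is_maximizer (MBD_defined N L J Y) (MBD N L J Y) m) \<and>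
      (MHRD_defined M L X m \<longrightarrow> is_maximizer (MHRD_defined M L X) (MHRD M L X) m) \<and>
      (IDD_defined M L X D m \<longrightarrow> is_maximizer (IDD_defined M L X D) (IDD M L X D) m)) \<and>
     (\<forall>m'. (AE t in L. m' t = m t) \<longrightarrow>
        (MBD_defined N L J Y m' \<longrightarrow> is_maximizer (MBD_defined N L J Y) (MBD N L J Y) m') \<and>
        (IDD_defined M L X D m' \<longrightarrow> is_maximizer (IDD_defined M L X D) (IDD M L X D) m')) \<and>
     (\<forall>m''. (\<integral>t. cdf (marginal M X t) (m'' t) \<partial>L) = 1/2 \<longrightarrow>
        MHRD_defined M L X m'' \<longrightarrow> is_maximizer (MHRD_defined M L X) (MHRD M L X) m'')"
proof -
  \<comment> \<open>A function equal to \<open>m\<close> almost everywhere is a median almost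
    everywhere; the instance \<open>m' = m\<close> lets parts (1) and (2) share one argument for
    \<open>MBD\<close> and \<open>IDD\<close>.\<close>
  have median_AE: "AE t in L. is_median (marginal M X t) (m' t)" if "AE t in L. m' t = m t" for m'
    using that AE_space by eventually_elim (simp add: assms(8))
  have MBD: "is_maximizer (MBD_defined N L J Y) (MBD N L J Y) m'"
    if "AE t in L. m' t = m t" "MBD_defined N L J Y m'" for m'
    using MBD_maximizer[OF assms(1-4,6,7) median_AE] that by blast
  have IDD: "is_maximizer (IDD_defined M L X D) (IDD M L X D) m'"
    if "AE t in L. m' t = m t" "IDD_defined M L X D m'" for m'
  proof (rule IDD_maximizer[OF _ that(2)])
    show "AE t in L. \<forall>y. D t (marginal M X t) y \<le> D t (marginal M X t) (m' t)"
      using median_AE[OF that(1)] AE_space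
      by eventually_elim (auto intro: assms(10) assms(7))
  qed
  have MHRD: "is_maximizer (MHRD_defined M L X) (MHRD M L X) m'"
    if "(\<integral>t. cdf (marginal M X t) (m' t) \<partial>L) = 1/2" "MHRD_defined M L X m'" for m'
    using MHRD_maximizer[OF assms(1,2,4,7)] that by blast
  show ?thesis
    using MBD[of m] IDD[of m] MHRD[OF integral_cdf_median[OF assms(1,2,4,7,8)]] MBD IDD MHRD
    by auto
qed

end
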